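(* Let $X=\oplus_{k=1}^\infty X_k$, $Y=\oplus_{k=1}^\infty Y_k$, $Z=\oplus_{k=1}^\infty Z_k$ (spaces of formal sums, see context), where all $X_k,Y_k,Z_k$ are finite-dimensional real vector spaces identified with Euclidean spaces, and give $X,Y,Z$ the product topology. Let $F\colon X\times Y\to Z$ be a map with $F(0,0)=0$ such that: the Fréchet derivative $DF\colon X\times Y\to Z$ of $F$ at $(0,0)$ is a well-defined linear map; $DF$ is homogeneous, i.e. $DF\colon X_k\times Y_k\to Z_k$ for every $k$; $QF:=F-DF$ satisfies $\pi_kQF(x,y)=\pi_kQF([x]_{k-1},[y]_{k-1})$ for all $k\ge1$; there is a solution operator $P\colon X\to Y$ with $F(x,P(x))=0$ for all $x\in X$ and $P(0)=0$; and $D_2F\colon Y\to Z$, $D_2F(y)=DF(0,y)$, is injective. Let $L\colon X\to Y$ be given by $L(x)=\sum_{k=1}^\infty\pi_kP(x_k)$ (under these hypotheses $L$ solves the linearized equation: $DF(x,L(x))=0$ for all $x\in X$). Assume that $X$ is endowed with a metric $d$ such that $d(x',x'')=\sup\{d(x'_k,x''_k): k=1,2,\ldots\}$ for $x',x''\in X$. Assume also that each $Y_k$ is endowed with a metric $\tilde d_k$ which is invariant under translation, and put $\tilde d(y',y'')=\sup\{\tilde d_k(y'_k,y''_k): k=1,2,\ldots\}$ for $y',y''\in Y$, and $\hat Y=\{y\in Y : \tilde d(y,0)<\infty\}$. Suppose that there exists $x^*\in X$ with $L(x^* )\notin\hat Y$, and let $\epsilon_0=d(x^*,0)$. Then for any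 $x\in X$ there is $x'\in X$ with $d(x,x')\le\epsilon_0$ such that $P(x')\notin\hat Y$.
   Context: Each $x\in X$ has a formal decomposition $x=x_1+x_2+\cdots$ with $x_k\in X_k$ (infinitely many $x_k$ may be nonzero), and similarly for $Y$ and $Z$; each $X_k$ (resp. $Y_k$, $Z_k$) is regarded as a subspace of $X$ (resp. $Y$, $Z$). $\pi_k$ denotes the projection $X\to X_k$, and also the projections $Y\to Y_k$ and $Z\to Z_k$. We write $[x]_k=x_1+\cdots+x_k$ and $[x]_0=0$, and similarly in $Y$. In the product topology a sequence converges if and only if each of its components converges. The sum defining $L$ is formal: $\pi_kL(x)=\pi_k(P(x_k))$. The Fréchet derivative of $F$ at $(0,0)$ is $DF(x,y)=\lim_{t\to0,\,t\in\mathbb{R}}\frac{F(tx,ty)-F(0,0)}{t}$ for $x\in X$, $y\in Y$.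
   Formalization: The metric d on X is also assumed translation invariant, and homogeneity of DF is taken to include π_k DF(x,y)=π_k DF(x_k,y_k) for infinite formal sums; without either assumption the literal claim is false. The remark DF(x,L(x))=0 is not asserted. *)

theory Defs
  imports "HOL-Analysis.Analysis"
begin

text \<open>
  The spaces \<open>X\<^sub>1, X\<^sub>2, \<dots>\<close> have unrelated dimensions, so they are finite-dimensional subspaces of
  one ambient real inner product space, which may be infinite-dimensional; each \<open>X\<^sub>k\<close> is then a
  Euclidean space with the induced inner product. A formal sum \<open>x\<^sub>1 + x\<^sub>2 + \<dots>\<close> is the function
  \<open>k \<mapsto> x\<^sub>k\<close>, with the dummy value \<open>0\<close> at the unused index \<open>0\<close>. The topology of the function type is
  the product topology, so its restriction to \<open>formal_sums V\<close> is the product topology of the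
  Euclidean spaces \<open>V\<^sub>k\<close>. Algebraic operations on formal sums are written out componentwise, since
  functions are not an instance of \<open>real_vector\<close>.
\<close>

definition findim_subspace :: "'a::real_inner set \<Rightarrow> bool" where
  "findim_subspace V \<longleftrightarrow> subspace V \<and> (\<exists>B. finite B \<and> V = span B)"

definition formal_sums :: "(nat \<Rightarrow> 'a::real_inner set) \<Rightarrow> (nat \<Rightarrow> 'a) set" where
  "formal_sums V = {x. x 0 = 0 \<and> (\<forall>k\<ge>1. x k \<in> V k)}"

abbreviation zero_sum :: "nat \<Rightarrow> 'a::real_inner" where
  "zero_sum \<equiv> (\<lambda>_. 0)"

text \<open>The embedding of the \<open>k\<close>-th summand into the space of formal sums.\<close>

definition emb :: "nat \<Rightarrow> 'a \<Rightarrow> nat \<Rightarrow> 'a::real_inner" where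
  "emb k v = (\<lambda>j. if j = k then v else 0)"

text \<open>The projection \<open>x \<mapsto> x\<^sub>k\<close>, with \<open>x\<^sub>k\<close> regarded as a formal sum. The value of \<open>x\<^sub>k\<close> in the
  space \<open>X\<^sub>k\<close> itself is \<open>x k\<close>.\<close>

definition proj :: "nat \<Rightarrow> (nat \<Rightarrow> 'a) \<Rightarrow> nat \<Rightarrow> 'a::real_inner" where
  "proj k x = emb k (x k)"

text \<open>The partial sum \<open>[x]\<^sub>k = x\<^sub>1 + \<dots> + x\<^sub>k\<close>.\<close>

definition trunc :: "nat \<Rightarrow> (nat \<Rightarrow> 'a) \<Rightarrow> nat \<Rightarrow> 'a::real_inner" where
  "trunc k x = (\<lambda>j. if 1 \<le> j \<and> j \<le> k then x j else 0)"

text \<open>\<open>DF\<close> is the derivative of \<open>F\<close> at \<open>(0,0)\<close>: for all \<open>(x,y)\<close> the limit of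
  \<open>(F(tx,ty) - F(0,0))/t\<close> as \<open>t \<rightarrow> 0\<close> exists in \<open>Z\<close>, and equals \<open>DF(x,y)\<close>.\<close>

definition derivative_at_origin ::
    "(nat \<Rightarrow> 'a::real_inner) set \<Rightarrow> (nat \<Rightarrow> 'b::real_inner) set \<Rightarrow> (nat \<Rightarrow> 'c::real_inner) set
     \<Rightarrow> ((nat \<Rightarrow> 'a) \<times> (nat \<Rightarrow> 'b) \<Rightarrow> nat \<Rightarrow> 'c) \<Rightarrow> ((nat \<Rightarrow> 'a) \<times> (nat \<Rightarrow> 'b) \<Rightarrow> nat \<Rightarrow> 'c) \<Rightarrow> bool" where
  "derivative_at_origin X Y Z F DF \<longleftrightarrow>
     (\<forall>x\<in>X. \<forall>y\<in>Y. DF (x, y) \<in> Z \<and>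
        ((\<lambda>t::real. (\<lambda>k. (F (\<lambda>j. t *\<^sub>R x j, \<lambda>j. t *\<^sub>R y j) k - F (zero_sum, zero_sum) k) /\<^sub>R t))
           \<longlongrightarrow> DF (x, y)) (at 0))"

definition linear_on_sums ::
    "(nat \<Rightarrow> 'a::real_inner) set \<Rightarrow> (nat \<Rightarrow> 'b::real_inner) set
     \<Rightarrow> ((nat \<Rightarrow> 'a) \<times> (nat \<Rightarrow> 'b) \<Rightarrow> nat \<Rightarrow> 'c::real_inner) \<Rightarrow> bool" where
  "linear_on_sums X Y T \<longleftrightarrow>
     (\<forall>x\<in>X. \<forall>y\<in>Y. \<forall>x'\<in>X. \<forall>y'\<in>Y.
        T (\<lambda>j. x j + x' j, \<lambda>j. y j + y' j) = (\<lambda>k. T (x, y) k + T (x', y') k)) \<and>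
     (\<forall>c. \<forall>x\<in>X. \<forall>y\<in>Y. T (\<lambda>j. c *\<^sub>R x j, \<lambda>j. c *\<^sub>R y j) = (\<lambda>k. c *\<^sub>R T (x, y) k))"

text \<open>A linear map \<open>T\<close> is homogeneous if it maps \<open>X\<^sub>k \<times> Y\<^sub>k\<close> to \<open>Z\<^sub>k\<close> and acts on formal sums
  degree by degree, \<open>\<pi>\<^sub>k T(x,y) = \<pi>\<^sub>k T(x\<^sub>k,y\<^sub>k)\<close>. The first clause determines a linear map only on
  finite sums. For a linear map satisfying the first clause, the second one is equivalent to
  continuity in the product topologies; it does not follow from linearity.\<close>

definition homogeneous ::
    "(nat \<Rightarrow> 'a::real_inner set) \<Rightarrow> (nat \<Rightarrow> 'b::real_inner set) \<Rightarrow> (nat \<Rightarrow> 'c::real_inner set)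
     \<Rightarrow> ((nat \<Rightarrow> 'a) \<times> (nat \<Rightarrow> 'b) \<Rightarrow> nat \<Rightarrow> 'c) \<Rightarrow> bool" where
  "homogeneous Xs Ys Zs T \<longleftrightarrow>
     (\<forall>k\<ge>1. \<forall>u\<in>Xs k. \<forall>v\<in>Ys k. \<exists>w\<in>Zs k. T (emb k u, emb k v) = emb k w) \<and>
     (\<forall>k\<ge>1. \<forall>x\<in>formal_sums Xs. \<forall>y\<in>formal_sums Ys. T (x, y) k = T (proj k x, proj k y) k)"

text \<open>The formal sum \<open>L(x) = \<Sum>\<^sub>k \<pi>\<^sub>k P(x\<^sub>k)\<close>; the value at the dummy index \<open>0\<close> is \<open>0\<close>.\<close>

definition lin_op ::
    "((nat \<Rightarrow> 'a::real_inner) \<Rightarrow> nat \<Rightarrow> 'b::real_inner) \<Rightarrow> (nat \<Rightarrow> 'a) \<Rightarrow> nat \<Rightarrow> 'b" where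
  "lin_op P x = (\<lambda>k. if k = 0 then 0 else P (proj k x) k)"

text \<open>The supremum may be infinite, hence the extended real values.\<close>

definition sup_dist ::
    "(nat \<Rightarrow> 'b \<Rightarrow> 'b \<Rightarrow> real) \<Rightarrow> (nat \<Rightarrow> 'b) \<Rightarrow> (nat \<Rightarrow> 'b) \<Rightarrow> ereal" where
  "sup_dist dY y' y'' = (SUP k\<in>{1..}. ereal (dY k (y' k) (y'' k)))"

definition Yhat ::
    "(nat \<Rightarrow> 'b::real_inner set) \<Rightarrow> (nat \<Rightarrow> 'b \<Rightarrow> 'b \<Rightarrow> real) \<Rightarrow> (nat \<Rightarrow> 'b) set" where
  "Yhat Ys dY = {y \<in> formal_sums Ys. sup_dist dY y zero_sum < \<infinity>}"

end

(*
  Subtracting the equations F(x, P x) = 0 and F(x', P x') = 0 for two points x, x' that agree below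
  degree k cancels the lower-order part QF in degree k. Injectivity of the linearization in y then
  forces (P x)_k - (P x')_k = (P (x_k - x'_k))_k. Hence replacing x_k by x_k + xstar_k, with the lower
  coordinates fixed, changes (P x)_k by exactly L(xstar)_k, so one of the two values is at least
  half as large as L(xstar)_k. Choosing between x_k and x_k + xstar_k degree by degree yields x'.
*)

theory Submission
  imports Defs
begin

section \<open>Formal sums, linear maps on them, and finite distance from zero\<close>

lemma emb_in_formal_sums:
  assumes "k \<ge> 1" "v \<in> V k" "\<And>j. j \<ge> 1 \<Longrightarrow> subspace (V j)"
  shows "emb k v \<in> formal_sums V"
  using assms by (auto simp: formal_sums_def emb_def subspace_0)

lemma zero_sum_in_formal_sums:
  assumes "\<And>j. j \<ge> 1 \<Longrightarrow> subspace (V j)"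
  shows "zero_sum \<in> formal_sums V"
  using assms by (auto simp: formal_sums_def subspace_0)

lemma proj_in_formal_sums:
  assumes "k \<ge> 1" "x \<in> formal_sums V" "\<And>j. j \<ge> 1 \<Longrightarrow> subspace (V j)"
  shows "proj k x \<in> formal_sums V"
  unfolding proj_def using assms by (intro emb_in_formal_sums) (auto simp: formal_sums_def)

lemma emb_zero [simp]: "emb k 0 = zero_sum"
  by (simp add: emb_def fun_eq_iff)

lemma linear_on_sums_diff:
  assumes T: "linear_on_sums (formal_sums V) (formal_sums W) T"
    and V: "\<And>j. j \<ge> 1 \<Longrightarrow> subspace (V j)" and W: "\<And>j. j \<ge> 1 \<Longrightarrow> subspace (W j)"
    and x: "x \<in> formal_sums V" "x' \<in> formal_sums V"
    and y: "y \<in> formal_sums W" "y' \<in> formal_sums W"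
  shows "T (\<lambda>j. x j - x' j, \<lambda>j. y j - y' j) k = T (x, y) k - T (x', y') k"
proof -
  have m: "(\<lambda>j. (-1) *\<^sub>R x' j) \<in> formal_sums V" "(\<lambda>j. (-1) *\<^sub>R y' j) \<in> formal_sums W"
    using x y V W by (auto simp: formal_sums_def subspace_neg)
  have "T (\<lambda>j. x j + (-1) *\<^sub>R x' j, \<lambda>j. y j + (-1) *\<^sub>R y' j) =
      (\<lambda>k. T (x, y) k + T (\<lambda>j. (-1) *\<^sub>R x' j, \<lambda>j. (-1) *\<^sub>R y' j) k)"
    by (rule T[unfolded linear_on_sums_def, THEN conjunct1, rule_format, OF x(1) y(1) m])
  moreover have "T (\<lambda>j. (-1) *\<^sub>R x' j, \<lambda>j. (-1) *\<^sub>R y' j) = (\<lambda>k. (-1) *\<^sub>R T (x', y') k)"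
    by (rule T[unfolded linear_on_sums_def, THEN conjunct2, rule_format, OF x(2) y(2)])
  ultimately show ?thesis
    by simp
qed

text \<open>A supremum in \<open>ereal\<close> is below infinity exactly when some real number
  bounds all its terms. From here on, boundedness is handled with a real bound
  \<open>M\<close>.\<close>

lemma mem_Yhat_iff:
  assumes "y \<in> formal_sums Ys"
  shows "y \<in> Yhat Ys dY \<longleftrightarrow> (\<exists>M. \<forall>k\<ge>1. dY k (y k) 0 \<le> M)"
proof
  assume "y \<in> Yhat Ys dY"
  then obtain n :: nat where n: "sup_dist dY y zero_sum < ereal (real n)"
    unfolding Yhat_def by (auto simp: less_PInf_Ex_of_nat)
  have "dY k (y k) 0 \<le> real n" if "k \<ge> 1" for k
  proof -
    have "ereal (dY k (y k) 0) \<le> sup_dist dY y zero_sum"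
      unfolding sup_dist_def using that by (intro SUP_upper) auto
    with n show ?thesis
      by (metis ereal_less_eq(3) order.strict_implies_order order.trans)
  qed
  then show "\<exists>M. \<forall>k\<ge>1. dY k (y k) 0 \<le> M"
    by blast
next
  assume "\<exists>M. \<forall>k\<ge>1. dY k (y k) 0 \<le> M"
  then obtain M where "\<forall>k\<ge>1. dY k (y k) 0 \<le> M" ..
  then have "sup_dist dY y zero_sum \<le> ereal M"
    unfolding sup_dist_def by (intro SUP_least) auto
  then show "y \<in> Yhat Ys dY"
    using assms by (auto simp: Yhat_def)
qed

section \<open>The graded equation and the behaviour of its solution operator in each degree\<close>

locale solved_graded_equation =
  fixes Xs :: "nat \<Rightarrow> 'a::real_inner set"
    and Ys :: "nat \<Rightarrow> 'b::real_inner set"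
    and Zs :: "nat \<Rightarrow> 'c::real_inner set"
    and F DF :: "(nat \<Rightarrow> 'a) \<times> (nat \<Rightarrow> 'b) \<Rightarrow> nat \<Rightarrow> 'c"
    and P :: "(nat \<Rightarrow> 'a) \<Rightarrow> nat \<Rightarrow> 'b"
  assumes Xs: "\<And>k. k \<ge> 1 \<Longrightarrow> subspace (Xs k)"
    and Ys: "\<And>k. k \<ge> 1 \<Longrightarrow> subspace (Ys k)"
    and DF_linear: "linear_on_sums (formal_sums Xs) (formal_sums Ys) DF"
    and DF_homogeneous: "homogeneous Xs Ys Zs DF"
    and QF_lower: "\<And>k x y. k \<ge> 1 \<Longrightarrow> x \<in> formal_sums Xs \<Longrightarrow> y \<in> formal_sums Ys \<Longrightarrow>
        F (x, y) k - DF (x, y) k =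
        F (trunc (k - 1) x, trunc (k - 1) y) k - DF (trunc (k - 1) x, trunc (k - 1) y) k"
    and P_maps: "P \<in> formal_sums Xs \<rightarrow> formal_sums Ys"
    and P_solves: "\<And>x. x \<in> formal_sums Xs \<Longrightarrow> F (x, P x) = zero_sum"
    and P_zero: "P zero_sum = zero_sum"
    and D2F_inj: "inj_on (\<lambda>y. DF (zero_sum, y)) (formal_sums Ys)"
begin

lemma P_component: "x \<in> formal_sums Xs \<Longrightarrow> k \<ge> 1 \<Longrightarrow> P x k \<in> Ys k"
  using P_maps by (auto simp: formal_sums_def)

text \<open>Subtracting cancels \<open>u\<close> and leaves
  \<open>DF (zero_sum, emb k (v - v'))\<close>, to which the injectivity of the linearization in y
  applies. Equality in the single degree \<open>k\<close> is enough because homogeneity makes the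
  other components vanish.\<close>

lemma DF_emb_inj:
  assumes k: "k \<ge> 1" and u: "u \<in> Xs k" and v: "v \<in> Ys k" "v' \<in> Ys k"
    and eq: "DF (emb k u, emb k v) k = DF (emb k u, emb k v') k"
  shows "v = v'"
proof -
  have emb: "emb k u \<in> formal_sums Xs" "emb k v \<in> formal_sums Ys" "emb k v' \<in> formal_sums Ys"
    and zero: "zero_sum \<in> formal_sums Xs" "zero_sum \<in> formal_sums Ys"
    using k u v Xs Ys by (auto intro: emb_in_formal_sums zero_sum_in_formal_sums)
  have vv: "v - v' \<in> Ys k"
    using k v Ys by (simp add: subspace_diff)
  have "(\<lambda>j. emb k v j - emb k v' j) = emb k (v - v')"
    by (auto simp: emb_def)
  then have "DF (zero_sum, emb k (v - v')) k = 0"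
    using linear_on_sums_diff[OF DF_linear Xs Ys emb(1,1,2,3), of k] eq by simp
  \<comment> \<open>Homogeneity confines the value to degree \<open>k\<close>, where it was just
    shown to be zero, so it is zero in every degree.\<close>
  moreover obtain w where "DF (emb k 0, emb k (v - v')) = emb k w"
    using DF_homogeneous k vv Xs[OF k, THEN subspace_0] unfolding homogeneous_def by blast
  ultimately have "DF (zero_sum, emb k (v - v')) = zero_sum"
    by (auto simp: emb_def fun_eq_iff)
  moreover have "DF (zero_sum, zero_sum) = zero_sum"
    using linear_on_sums_diff[OF DF_linear Xs Ys zero(1,1,2,2)] by (simp add: fun_eq_iff)
  ultimately have "emb k (v - v') = zero_sum"
    by (intro inj_onD[OF D2F_inj] emb_in_formal_sums k vv Ys zero) auto
  then show ?thesis
    by (metis emb_def right_minus_eq)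
qed

text \<open>In degree \<open>k\<close> the lower-order part sees only degrees below
  \<open>k\<close>, where the two solutions agree, so it cancels and only \<open>DF\<close> remains.
  The agreement of \<open>P x\<close> and \<open>P x'\<close> is a separate assumption because the
  inductive proof of \<open>P_local\<close> supplies it from its induction hypothesis.\<close>

lemma DF_solution_diff:
  assumes k: "k \<ge> 1" and x: "x \<in> formal_sums Xs" "x' \<in> formal_sums Xs"
    and agree: "\<And>j. 1 \<le> j \<Longrightarrow> j < k \<Longrightarrow> x j = x' j"
    and agreeP: "\<And>j. 1 \<le> j \<Longrightarrow> j < k \<Longrightarrow> P x j = P x' j"
  shows "DF (emb k (x k - x' k), emb k (P x k - P x' k)) k = 0"
proof -
  have y: "P x \<in> formal_sums Ys" "P x' \<in> formal_sums Ys"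
    using x P_maps by auto
  have "trunc (k - 1) x = trunc (k - 1) x'" "trunc (k - 1) (P x) = trunc (k - 1) (P x')"
    using agree agreeP by (auto simp: trunc_def fun_eq_iff)
  \<comment> \<open>Both values of \<open>F\<close> are zero, so each side is the degree
    \<open>k\<close> part of \<open>F - DF\<close>, which depends only on the common
    truncations.\<close>
  then have "- DF (x, P x) k = - DF (x', P x') k"
    using QF_lower[OF k x(1) y(1)] QF_lower[OF k x(2) y(2)] P_solves[OF x(1)] P_solves[OF x(2)]
    by simp
  then have "DF (x, P x) k = DF (x', P x') k"
    by simp
  then have "DF (proj k x, proj k (P x)) k = DF (proj k x', proj k (P x')) k"
    using DF_homogeneous k x y unfolding homogeneous_def by metis
  moreover have "DF (\<lambda>j. proj k x j - proj k x' j, \<lambda>j. proj k (P x) j - proj k (P x') j) k =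
      DF (proj k x, proj k (P x)) k - DF (proj k x', proj k (P x')) k"
    by (intro linear_on_sums_diff[OF DF_linear] proj_in_formal_sums Xs Ys k x y)
  moreover have "(\<lambda>j. proj k x j - proj k x' j) = emb k (x k - x' k)"
    "(\<lambda>j. proj k (P x) j - proj k (P x') j) = emb k (P x k - P x' k)"
    by (auto simp: proj_def emb_def)
  ultimately show ?thesis
    by simp
qed

text \<open>By strong induction the solutions already agree below degree \<open>k\<close>; their
  difference in degree \<open>k\<close> then solves the linearized equation with zero x-part, so it
  vanishes by injectivity.\<close>

lemma P_local:
  assumes x: "x \<in> formal_sums Xs" "x' \<in> formal_sums Xs"
    and "k \<ge> 1" and agree: "\<And>j. 1 \<le> j \<Longrightarrow> j \<le> k \<Longrightarrow> x j = x' j"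
  shows "P x k = P x' k"
  using assms(3,4)
proof (induction k rule: less_induct)
  case (less k)
  have "DF (emb k (x k - x' k), emb k (P x k - P x' k)) k = 0"
    using less by (intro DF_solution_diff x) auto
  \<comment> \<open>Comparing \<open>x\<close> with itself yields the zero value.\<close>
  moreover have "DF (emb k 0, emb k 0) k = 0"
    using DF_solution_diff[OF less.prems(1) x(1,1)] by simp
  ultimately have "DF (emb k 0, emb k (P x k - P x' k)) k = DF (emb k 0, emb k 0) k"
    using less.prems by simp
  then have "P x k - P x' k = 0"
    using less.prems(1) Xs x
    by (intro DF_emb_inj[of k 0] subspace_diff subspace_0 P_component Ys) auto
  then show ?case
    by simp
qed

text \<open>Both sides solve the same linearized equation in degree \<open>k\<close> with x-part
  \<open>x k - x' k\<close>, and such a solution is unique by \<open>DF_emb_inj\<close>.\<close>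

lemma P_diff:
  assumes x: "x \<in> formal_sums Xs" "x' \<in> formal_sums Xs"
    and k: "k \<ge> 1" and agree: "\<And>j. 1 \<le> j \<Longrightarrow> j < k \<Longrightarrow> x j = x' j"
  shows "P x k - P x' k = P (emb k (x k - x' k)) k"
proof -
  define u where "u = x k - x' k"
  have u: "u \<in> Xs k"
    using x k Xs by (auto simp: u_def formal_sums_def intro: subspace_diff)
  have eu: "emb k u \<in> formal_sums Xs" and zero: "zero_sum \<in> formal_sums Xs"
    using u k Xs by (auto intro: emb_in_formal_sums zero_sum_in_formal_sums)
  have "DF (emb k u, emb k (P x k - P x' k)) k = 0"
    unfolding u_def by (intro DF_solution_diff k x P_local) (auto intro: agree)
  \<comment> \<open>The right-hand side arises by comparing \<open>emb k u\<close> with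
    \<open>zero_sum\<close>: they agree below degree \<open>k\<close>, and \<open>P zero_sum\<close>
    is zero.\<close>
  moreover have "DF (emb k (emb k u k - 0), emb k (P (emb k u) k - P zero_sum k)) k = 0"
    by (intro DF_solution_diff k eu zero P_local) (auto simp: emb_def)
  then have "DF (emb k u, emb k (P (emb k u) k)) k = 0"
    by (simp add: P_zero) (simp add: emb_def)
  ultimately show ?thesis
    unfolding u_def[symmetric] by (intro DF_emb_inj[of k u] subspace_diff P_component Ys k u x eu) simp
qed

section \<open>Degree-by-degree choice of the perturbation\<close>

text \<open>By \<open>P_diff\<close>, the two candidates in degree \<open>k\<close> give solutions
  whose components there differ by \<open>lin_op P z k\<close>. Invariance and the triangle
  inequality make one of them at least half that size. Later choices do no harm, by
  \<open>P_local\<close>.\<close>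

lemma ex_perturbation_with_large_solution:
  assumes dY_metric: "\<And>k. k \<ge> 1 \<Longrightarrow> Metric_space (Ys k) (dY k)"
    and dY_invariant: "\<And>k u v w. k \<ge> 1 \<Longrightarrow> u \<in> Ys k \<Longrightarrow> v \<in> Ys k \<Longrightarrow> w \<in> Ys k \<Longrightarrow>
        dY k (v + u) (w + u) = dY k v w"
    and x: "x \<in> formal_sums Xs" and z: "z \<in> formal_sums Xs"
  obtains x' where "x' \<in> formal_sums Xs"
    "\<And>k. k \<ge> 1 \<Longrightarrow> x' k = x k \<or> x' k = x k + z k"
    "\<And>k. k \<ge> 1 \<Longrightarrow> dY k (lin_op P z k) 0 \<le> 2 * dY k (P x' k) 0"
proof -
  \<comment> \<open>\<open>P\<close> needs a complete formal sum while only the degrees below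
    \<open>k\<close> have been chosen. The zero tail is harmless: by \<open>P_local\<close> it does
    not affect degree \<open>k\<close>.\<close>
  define ext where "ext f k r = (\<lambda>j::nat. if j < k then f j else if j = k then r else 0)"
    for f :: "nat \<Rightarrow> 'a" and k r
  \<comment> \<open>At the dummy index the only admissible value is 0, as membership in
    \<open>formal_sums\<close> requires.\<close>
  define good where "good f k r \<longleftrightarrow> (if k = 0 then r = 0 else
      (r = x k \<or> r = x k + z k) \<and> dY k (lin_op P z k) 0 \<le> 2 * dY k (P (ext f k r) k) 0)"
    for f k r
  have mem: "r \<in> Xs k" if "good f k r" "k \<ge> 1" for f k r
    using that x z Xs[OF that(2)] by (auto simp: good_def formal_sums_def subspace_add split: if_splits)
  have ext_mem: "ext f k r \<in> formal_sums Xs"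
    if "k \<ge> 1" "r \<in> Xs k" "\<And>j. j < k \<Longrightarrow> good f j (f j)" for f k r
  proof -
    have "f 0 = 0"
      using that(1) that(3)[of 0] by (simp add: good_def)
    then show ?thesis
      using that mem Xs by (auto simp: formal_sums_def ext_def subspace_0)
  qed
  \<comment> \<open>The recursion needs two facts: \<open>good f k r\<close> depends on
    \<open>f\<close> only below \<open>k\<close>, and an admissible \<open>r\<close> exists whenever
    all earlier choices are admissible.\<close>
  have "\<exists>f. \<forall>k. good f k (f k)"
  proof (rule dependent_wellorder_choice)
    fix r :: 'a and f g :: "nat \<Rightarrow> 'a" and k :: nat
    assume "\<And>j. j < k \<Longrightarrow> f j = g j"
    then have "ext f k r = ext g k r"
      by (auto simp: ext_def)
    then show "good f k r = good g k r"
      by (simp add: good_def)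
  next
    fix k :: nat and f :: "nat \<Rightarrow> 'a"
    assume prev: "\<And>j. j < k \<Longrightarrow> good f j (f j)"
    show "\<exists>r. good f k r"
    proof (cases "k = 0")
      case True
      then show ?thesis by (simp add: good_def)
    next
      case False
      then have k: "k \<ge> 1" by simp
      interpret Metric_space "Ys k" "dY k"
        by (rule dY_metric[OF k])
      define a b where "a = P (ext f k (x k)) k" and "b = P (ext f k (x k + z k)) k"
      have xz: "x k \<in> Xs k" "x k + z k \<in> Xs k"
        using k x z Xs by (auto simp: formal_sums_def subspace_add)
      have e: "ext f k (x k) \<in> formal_sums Xs" "ext f k (x k + z k) \<in> formal_sums Xs"
        using ext_mem[OF k _ prev] xz by auto
      have ab: "a \<in> Ys k" "b \<in> Ys k" and zero: "0 \<in> Ys k"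
        unfolding a_def b_def using e k Ys by (auto intro: P_component subspace_0)
      have ba: "b - a = lin_op P z k"
        unfolding a_def b_def using P_diff[OF e(2,1) k] False
        by (simp add: ext_def lin_op_def proj_def)
      have "b - a \<in> Ys k"
        using ab Ys[OF k] by (simp add: subspace_diff)
      \<comment> \<open>Translation by \<open>a\<close> carries the pair \<open>b - a\<close>,
        \<open>0\<close> to \<open>b\<close>, \<open>a\<close>.\<close>
      then have "dY k (b - a) 0 = dY k b a"
        using dY_invariant[OF k ab(1) _ zero, of "b - a"] by simp
      also have "\<dots> \<le> dY k b 0 + dY k a 0"
        using triangle[OF ab(2) zero ab(1)] by (simp add: commute)
      finally have "dY k (lin_op P z k) 0 \<le> 2 * dY k a 0 \<or> dY k (lin_op P z k) 0 \<le> 2 * dY k b 0"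
        unfolding ba by linarith
      then show ?thesis
        using False unfolding good_def a_def b_def by auto
    qed
  qed
  then obtain x' where x': "\<And>k. good x' k (x' k)" by blast
  have x'_mem: "x' \<in> formal_sums Xs"
    using mem[OF x'] x'[of 0] by (auto simp: formal_sums_def good_def)
  show ?thesis
  proof
    fix k :: nat assume k: "k \<ge> 1"
    then show "x' k = x k \<or> x' k = x k + z k"
      using x'[of k] by (simp add: good_def)
    \<comment> \<open>Locality replaces the extension used at stage \<open>k\<close> by the
      completed sequence.\<close>
    have "P (ext x' k (x' k)) k = P x' k"
      by (rule P_local[OF ext_mem[OF k mem[OF x' k] x'] x'_mem k]) (auto simp: ext_def)
    then show "dY k (lin_op P z k) 0 \<le> 2 * dY k (P x' k) 0"
      using x'[of k] k by (simp add: good_def)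
  qed (rule x'_mem)
qed

end

section \<open>Size of the perturbation\<close>

text \<open>Since \<open>d\<close> is a supremum over degrees, each degree can be treated alone. The
  contribution is 0 where the coordinate was kept; elsewhere, after a translation, it is the
  distance of \<open>proj k z\<close> from zero, which is one of the terms of the supremum for
  \<open>d z zero_sum\<close>.\<close>

lemma dist_perturbation_le:
  assumes Xs: "\<And>k. k \<ge> 1 \<Longrightarrow> subspace (Xs k)"
    and d_metric: "Metric_space (formal_sums Xs) d"
    and d_sup: "\<And>x' x''. x' \<in> formal_sums Xs \<Longrightarrow> x'' \<in> formal_sums Xs \<Longrightarrow>
        ereal (d x' x'') = (SUP k\<in>{1..}. ereal (d (proj k x') (proj k x'')))"
    and d_invariant: "\<And>u x' x''. u \<in> formal_sums Xs \<Longrightarrow> x' \<in> formal_sums Xs \<Longrightarrow>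
        x'' \<in> formal_sums Xs \<Longrightarrow> d (\<lambda>j. x' j + u j) (\<lambda>j. x'' j + u j) = d x' x''"
    and x: "x \<in> formal_sums Xs" "x' \<in> formal_sums Xs" and z: "z \<in> formal_sums Xs"
    and x': "\<And>k. k \<ge> 1 \<Longrightarrow> x' k = x k \<or> x' k = x k + z k"
  shows "d x x' \<le> d z zero_sum"
proof -
  interpret Metric_space "formal_sums Xs" d
    by (rule d_metric)
  have zero: "zero_sum \<in> formal_sums Xs"
    using Xs by (rule zero_sum_in_formal_sums)
  have "ereal (d (proj k x) (proj k x')) \<le> ereal (d z zero_sum)" if k: "k \<ge> 1" for k
    using x'[OF k]
  proof
    assume "x' k = x k"
    then have "d (proj k x) (proj k x') = 0"
      using proj_in_formal_sums[OF k x(1) Xs] by (simp add: proj_def)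
    then show ?thesis
      by simp
  next
    assume eq: "x' k = x k + z k"
    have "d (\<lambda>j. proj k z j + proj k x j) (\<lambda>j. 0 + proj k x j) = d (proj k z) zero_sum"
      by (intro d_invariant proj_in_formal_sums Xs k x z zero)
    moreover have "(\<lambda>j. proj k z j + proj k x j) = proj k x'"
      by (auto simp: eq proj_def emb_def add.commute)
    ultimately have "d (proj k x) (proj k x') = d (proj k z) (proj k zero_sum)"
      by (subst commute) (simp add: proj_def)
    also have "ereal \<dots> \<le> ereal (d z zero_sum)"
      unfolding d_sup[OF z zero] using k by (intro SUP_upper) auto
    finally show ?thesis .
  qed
  then have "ereal (d x x') \<le> ereal (d z zero_sum)"
    unfolding d_sup[OF x] by (intro SUP_least) auto
  then show ?thesis
    by simp
qed

theorem lemma3p2: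
  fixes Xs :: "nat \<Rightarrow> 'a::real_inner set"
    and Ys :: "nat \<Rightarrow> 'b::real_inner set"
    and Zs :: "nat \<Rightarrow> 'c::real_inner set"
    and X :: "(nat \<Rightarrow> 'a) set" and Y :: "(nat \<Rightarrow> 'b) set" and Z :: "(nat \<Rightarrow> 'c) set"
    and F DF :: "(nat \<Rightarrow> 'a) \<times> (nat \<Rightarrow> 'b) \<Rightarrow> nat \<Rightarrow> 'c"
    and P :: "(nat \<Rightarrow> 'a) \<Rightarrow> nat \<Rightarrow> 'b"
    and d :: "(nat \<Rightarrow> 'a) \<Rightarrow> (nat \<Rightarrow> 'a) \<Rightarrow> real"
    and dY :: "nat \<Rightarrow> 'b \<Rightarrow> 'b \<Rightarrow> real"
    and xstar :: "nat \<Rightarrow> 'a" and \<epsilon>0 :: real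
  assumes findim: "\<And>k. k \<ge> 1 \<Longrightarrow>
        findim_subspace (Xs k) \<and> findim_subspace (Ys k) \<and> findim_subspace (Zs k)"
    and X_def: "X = formal_sums Xs" and Y_def: "Y = formal_sums Ys" and Z_def: "Z = formal_sums Zs"
    and F_maps: "F \<in> X \<times> Y \<rightarrow> Z"
    and F_zero: "F (zero_sum, zero_sum) = zero_sum"
    and DF_deriv: "derivative_at_origin X Y Z F DF"
    and DF_linear: "linear_on_sums X Y DF"
    and DF_homogeneous: "homogeneous Xs Ys Zs DF"
    and QF_lower: "\<And>k x y. k \<ge> 1 \<Longrightarrow> x \<in> X \<Longrightarrow> y \<in> Y \<Longrightarrow>
        F (x, y) k - DF (x, y) k =
        F (trunc (k - 1) x, trunc (k - 1) y) k - DF (trunc (k - 1) x, trunc (k - 1) y) k"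
    and P_maps: "P \<in> X \<rightarrow> Y"
    and P_solves: "\<And>x. x \<in> X \<Longrightarrow> F (x, P x) = zero_sum"
    and P_zero: "P zero_sum = zero_sum"
    and D2F_inj: "inj_on (\<lambda>y. DF (zero_sum, y)) Y"
    and d_metric: "Metric_space X d"
    and d_sup: "\<And>x' x''. x' \<in> X \<Longrightarrow> x'' \<in> X \<Longrightarrow>
        ereal (d x' x'') = (SUP k\<in>{1..}. ereal (d (proj k x') (proj k x'')))"
    and d_invariant: "\<And>u x' x''. u \<in> X \<Longrightarrow> x' \<in> X \<Longrightarrow> x'' \<in> X \<Longrightarrow>
        d (\<lambda>j. x' j + u j) (\<lambda>j. x'' j + u j) = d x' x''"
    and dY_metric: "\<And>k. k \<ge> 1 \<Longrightarrow> Metric_space (Ys k) (dY k)"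
    and dY_invariant: "\<And>k u v w. k \<ge> 1 \<Longrightarrow> u \<in> Ys k \<Longrightarrow> v \<in> Ys k \<Longrightarrow> w \<in> Ys k \<Longrightarrow>
        dY k (v + u) (w + u) = dY k v w"
    and xstar: "xstar \<in> X" "lin_op P xstar \<notin> Yhat Ys dY"
    and eps: "\<epsilon>0 = d xstar zero_sum"
  shows "\<forall>x\<in>X. \<exists>x'\<in>X. d x x' \<le> \<epsilon>0 \<and> P x' \<notin> Yhat Ys dY"
proof
  fix x assume "x \<in> X"
  then have x: "x \<in> formal_sums Xs" by (simp add: X_def)
  have Xs: "subspace (Xs k)" and Ys: "subspace (Ys k)" if "k \<ge> 1" for k
    using findim[OF that] by (auto simp: findim_subspace_def)
  interpret solved_graded_equation Xs Ys Zs F DF P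
    using Xs Ys DF_linear DF_homogeneous QF_lower P_maps P_solves P_zero D2F_inj
    unfolding X_def Y_def by unfold_locales
  note z = xstar(1)[unfolded X_def]
  obtain x' where x': "x' \<in> formal_sums Xs"
    "\<And>k. k \<ge> 1 \<Longrightarrow> x' k = x k \<or> x' k = x k + xstar k"
    "\<And>k. k \<ge> 1 \<Longrightarrow> dY k (lin_op P xstar k) 0 \<le> 2 * dY k (P x' k) 0"
    using ex_perturbation_with_large_solution[OF dY_metric dY_invariant x z] by blast
  have "d x x' \<le> \<epsilon>0"
    unfolding eps
    by (rule dist_perturbation_le[OF Xs d_metric[unfolded X_def] d_sup[unfolded X_def]
          d_invariant[unfolded X_def] x x'(1) z x'(2)])
  moreover have "P x' \<notin> Yhat Ys dY"
  proof
    assume "P x' \<in> Yhat Ys dY"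
    moreover have "P x' \<in> formal_sums Ys"
      using x'(1) P_maps by (auto simp: X_def Y_def)
    ultimately obtain M where M: "\<And>k. k \<ge> 1 \<Longrightarrow> dY k (P x' k) 0 \<le> M"
      using mem_Yhat_iff by blast
    \<comment> \<open>A bound on \<open>P x'\<close> would also bound \<open>lin_op P xstar\<close>,
      with twice the constant, contrary to the choice of \<open>xstar\<close>.\<close>
    have "dY k (lin_op P xstar k) 0 \<le> 2 * M" if "k \<ge> 1" for k
      using x'(3)[OF that] M[OF that] by linarith
    moreover have "lin_op P xstar \<in> formal_sums Ys"
      using P_component proj_in_formal_sums[OF _ z Xs] by (auto simp: lin_op_def formal_sums_def)
    ultimately show False
      using xstar(2) mem_Yhat_iff by blast
  qed
  ultimately show "\<exists>x'\<in>X. d x x' \<le> \<epsilon>0 \<and> P x' \<notin> Yhat Ys dY"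
    using x'(1) by (auto simp: X_def)
qed

end
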